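(* Let $\Omega\subseteq\mathbb R^2$ be an open connected set and let $\phi\in C^2(\Omega,\mathbb R^2)$ satisfy $\det d\phi>0$ and have constant singular values (i.e. the singular values of $d\phi_x$ do not depend on $x\in\Omega$). Suppose that $\phi$ is $E_p$-critical for some $p\ge1$. Then $\phi$ is either affine or satisfies $d\phi\in K$ everywhere on $\Omega$.
   Context: $K$ is the set of real $2\times2$ matrices $A$ with $\det A\ge0$ and $\sigma_1(A)+\sigma_2(A)=1$, where $\sigma_1(A),\sigma_2(A)$ are the singular values of $A$. $E_p$ is the functional $\phi\mapsto\int_\Omega\operatorname{dist}^p(d\phi,\operatorname{SO}_2)\,dx$ (up to normalization by area), with $\operatorname{dist}$ the Frobenius distance on $2\times2$ matrices. A map $\phi\in C^2(\Omega,\mathbb R^2)$ with $\det d\phi>0$ is $E_p$-critical if it satisfies the Euler–Lagrange equation $$\operatorname{div}\Big(\operatorname{dist}^{p-2}(d\phi,\operatorname{SO}_2)\,\big(d\phi-O(d\phi)\big)\Big)=0,$$ where $\operatorname{div}$ is the row-by-row divergence, $O(A)=A(\sqrt{A^TA})^{-1}$ is the orthogonal polar factor of $A$, and the expression in parentheses is taken to be $0$ where $d\phi\in\operatorname{SO}_2$. *)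

theory Defs
  imports "HOL-Analysis.Analysis"
begin

definition eigenvalues :: "real^2^2 \<Rightarrow> real set" where
  "eigenvalues M = {l. \<exists>v. v \<noteq> 0 \<and> M *v v = l *\<^sub>R v}"

text \<open>The singular values of \<open>A\<close> are the square roots of the two eigenvalues, counted with
  multiplicity, of the symmetric matrix \<open>A\<^sup>TA\<close>. In dimension two these are the largest
  and the smallest element of the set of eigenvalues, which coincide for a double eigenvalue.\<close>

definition sigma1 :: "real^2^2 \<Rightarrow> real" where
  "sigma1 A = sqrt (Max (eigenvalues (transpose A ** A)))"

definition sigma2 :: "real^2^2 \<Rightarrow> real" where
  "sigma2 A = sqrt (Min (eigenvalues (transpose A ** A)))"

definition K :: "(real^2^2) set" where
  "K = {A. det A \<ge> 0 \<and> sigma1 A + sigma2 A = 1}"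

definition SO2 :: "(real^2^2) set" where
  "SO2 = {Q. rotation_matrix Q}"

text \<open>\<open>mat_sqrt M\<close> is the unique symmetric positive semidefinite square root; it is only
  meaningful for symmetric positive semidefinite \<open>M\<close>.\<close>

definition mat_sqrt :: "real^2^2 \<Rightarrow> real^2^2" where
  "mat_sqrt M = (THE S. transpose S = S \<and> (\<forall>v. 0 \<le> v \<bullet> (S *v v)) \<and> S ** S = M)"

definition polar_factor :: "real^2^2 \<Rightarrow> real^2^2" where
  "polar_factor A = A ** matrix_inv (mat_sqrt (transpose A ** A))"

text \<open>The metric on \<^typ>\<open>real^2^2\<close> is the one induced by the Frobenius norm, so
  \<open>infdist A SO2\<close> is the Frobenius distance of \<open>A\<close> to \<open>SO2\<close>.\<close>

definition EL_field :: "real \<Rightarrow> real^2^2 \<Rightarrow> real^2^2" where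
  "EL_field p A =
     (if A \<in> SO2 then 0 else (infdist A SO2 powr (p - 2)) *\<^sub>R (A - polar_factor A))"

text \<open>Row-by-row divergence at \<open>x\<close>: the \<open>i\<close>-th component is \<open>\<Sum>j. \<partial>\<^sub>j F\<^sub>i\<^sub>j\<close>, where
  \<open>G $ i $ j\<close> is the partial derivative of \<open>F\<^sub>i\<^sub>j\<close> in the \<open>j\<close>-th coordinate.\<close>

definition has_row_divergence :: "(real^2 \<Rightarrow> real^2^2) \<Rightarrow> real^2 \<Rightarrow> real^2 \<Rightarrow> bool" where
  "has_row_divergence F d x \<longleftrightarrow>
     (\<exists>G::real^2^2.
        (\<forall>i j. ((\<lambda>t. F (x + t *\<^sub>R axis j 1) $ i $ j) has_real_derivative G $ i $ j) (at 0)) \<and>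
        d = (\<chi> i. \<Sum>j\<in>UNIV. G $ i $ j))"

definition Ep_critical :: "real \<Rightarrow> (real^2) set \<Rightarrow> (real^2 \<Rightarrow> real^2) \<Rightarrow> bool" where
  "Ep_critical p \<Omega> \<phi> \<longleftrightarrow>
     (\<forall>x\<in>\<Omega>. has_row_divergence (\<lambda>y. EL_field p (jacobian \<phi> (at y))) 0 x)"

definition C2_on :: "(real^2) set \<Rightarrow> (real^2 \<Rightarrow> real^2) \<Rightarrow> bool" where
  "C2_on \<Omega> \<phi> \<longleftrightarrow>
     (\<exists>(D :: real^2 \<Rightarrow> (real^2) \<Rightarrow>\<^sub>L (real^2))
        (D2 :: real^2 \<Rightarrow> (real^2) \<Rightarrow>\<^sub>L ((real^2) \<Rightarrow>\<^sub>L (real^2))).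
        (\<forall>x\<in>\<Omega>. (\<phi> has_derivative blinfun_apply (D x)) (at x)) \<and>
        (\<forall>x\<in>\<Omega>. (D has_derivative blinfun_apply (D2 x)) (at x)) \<and>
        continuous_on \<Omega> D2)"

definition affine_map_on :: "(real^2) set \<Rightarrow> (real^2 \<Rightarrow> real^2) \<Rightarrow> bool" where
  "affine_map_on \<Omega> \<phi> \<longleftrightarrow> (\<exists>A b. \<forall>x\<in>\<Omega>. \<phi> x = A *v x + b)"

end

theory Submission
  imports Defs
begin

text \<open>Write \<open>d\<phi>\<close> as the sum of its conformal part (the complex number \<open>\<partial>\<phi>/\<partial>z\<close>, of modulus \<open>r\<close>) and its
  anticonformal part (\<open>\<partial>\<phi>/\<partial>(cnj z)\<close>, of modulus \<open>s\<close>). The singular values are \<open>r + s\<close> and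
  \<open>\<bar>r - s\<bar>\<close>, so \<open>r\<close> and \<open>s\<close> are constant with \<open>s < r\<close>, and the orthogonal polar factor is
  the conformal part divided by \<open>r\<close>. If \<open>s > 0\<close>, the distance to \<open>SO2\<close> is a positive constant,
  and since cofactor matrices are divergence free the Euler--Lagrange equation becomes
  \<open>(1 - 1/(2r)) \<Delta>\<phi> = 0\<close>. So either \<open>2r = 1\<close>, which is \<open>d\<phi> \<in> K\<close>, or \<open>\<phi>\<close> is harmonic; if
  \<open>s = 0\<close>, then \<open>\<phi>\<close> is holomorphic and thus harmonic anyway. For harmonic \<open>\<phi>\<close> the two parts are
  holomorphic and antiholomorphic functions of constant modulus, hence constant.\<close>

section \<open>Symmetry of second derivatives\<close>

text \<open>Mean value inequality for the difference of \<open>f\<close> along two parallel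
  segments: its derivative is a difference of two values of \<open>D\<close> applied to a multiple
  of \<open>v\<close>, and the expansion of \<open>D\<close> at \<open>x\<close> compares that
  difference with \<open>t\<close> times \<open>D2 u\<close>.\<close>

lemma second_difference_bound:
  fixes f :: "'a::real_normed_vector \<Rightarrow> 'b::real_normed_vector"
    and D :: "'a \<Rightarrow> 'a \<Rightarrow>\<^sub>L 'b"
  assumes f: "\<And>y. norm (y - x) < d \<Longrightarrow> (f has_derivative blinfun_apply (D y)) (at y)"
    and D: "\<And>y. norm (y - x) < d \<Longrightarrow> norm (D y - D x - D2 (y - x)) \<le> e * norm (y - x)"
    and lin: "linear D2"
    and t: "0 < t" "t * (norm u + norm v) < d" and e: "0 \<le> e"
  shows "norm (f (x + t *\<^sub>R u + t *\<^sub>R v) - f (x + t *\<^sub>R u) - f (x + t *\<^sub>R v) + f x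
               - (t * t) *\<^sub>R D2 u v)
         \<le> e * (t * t) * (2 * (norm u + norm v) * norm v)"
proof -
  define w where "w = (t * t) *\<^sub>R D2 u v"
  define N where "N = norm u + norm v"
  \<comment> \<open>\<open>k 1 - k 0\<close> is the quantity to be bounded; \<open>r\<close> moves
    both base points in direction \<open>v\<close>.\<close>
  define k where "k = (\<lambda>r. f (x + t *\<^sub>R u + (r * t) *\<^sub>R v) - f (x + (r * t) *\<^sub>R v) - r *\<^sub>R w)"
  define k' where "k' = (\<lambda>r h::real. D (x + t *\<^sub>R u + (r * t) *\<^sub>R v) ((h * t) *\<^sub>R v)
                    - D (x + (r * t) *\<^sub>R v) ((h * t) *\<^sub>R v) - h *\<^sub>R w)"
  define B where "B = e * (t * t) * (2 * N * norm v)"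
  have n1: "norm (t *\<^sub>R u + (r * t) *\<^sub>R v) \<le> t * N"
    and n2: "norm ((r * t) *\<^sub>R v) \<le> t * N" if "0 \<le> r" "r \<le> 1" for r
  proof -
    have "r * (t * norm v) \<le> 1 * (t * norm v)"
      by (rule mult_right_mono) (use that t in auto)
    moreover have "norm (t *\<^sub>R u + (r * t) *\<^sub>R v) \<le> t * norm u + r * t * norm v"
      using norm_triangle_ineq[of "t *\<^sub>R u" "(r * t) *\<^sub>R v"] that t by simp
    ultimately show "norm (t *\<^sub>R u + (r * t) *\<^sub>R v) \<le> t * N"
      by (simp add: N_def algebra_simps)
    have "0 \<le> t * norm u" using t by simp
    with \<open>r * (t * norm v) \<le> 1 * (t * norm v)\<close>
    have "r * (t * norm v) \<le> t * norm u + t * norm v" by linarith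
    with that t show "norm ((r * t) *\<^sub>R v) \<le> t * N"
      by (simp add: N_def distrib_left mult.assoc)
  qed
  have der: "(k has_derivative k' r) (at r within {0..1})" if "r \<in> {0..1}" for r
  proof -
    have "norm ((x + t *\<^sub>R u + (r * t) *\<^sub>R v) - x) < d" "norm ((x + (r * t) *\<^sub>R v) - x) < d"
      using le_less_trans[OF n1 t(2)[folded N_def]] le_less_trans[OF n2 t(2)[folded N_def]] that
      by (auto simp: add.assoc)
    note f1 = has_derivative_compose[where f = "\<lambda>r. x + t *\<^sub>R u + (r * t) *\<^sub>R v", OF _ f[OF this(1)]]
     and f2 = has_derivative_compose[where f = "\<lambda>r. x + (r * t) *\<^sub>R v", OF _ f[OF this(2)]]
    show ?thesis unfolding k_def k'_def
      by (rule derivative_eq_intros f1 f2 refl | simp)+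
  qed
  have bd: "onorm (k' r) \<le> B" if "r \<in> {0..1}" for r
  proof (rule onorm_le)
    fix h :: real
    define y1 where "y1 = t *\<^sub>R u + (r * t) *\<^sub>R v"
    define y2 where "y2 = (r * t) *\<^sub>R v"
    define E where "E = (\<lambda>y. D (x + y) - D x - D2 y)"
    have y: "norm y1 \<le> t * N" "norm y2 \<le> t * N"
      unfolding y1_def y2_def using n1 n2 that by auto
    then have "norm y1 < d" "norm y2 < d" using t by (auto simp: N_def)
    then have "norm (E y1) \<le> e * norm y1" "norm (E y2) \<le> e * norm y2"
      using D[of "x + y1"] D[of "x + y2"] by (auto simp: E_def)
    moreover have "e * norm y1 \<le> e * (t * N)" "e * norm y2 \<le> e * (t * N)"
      using y e by (auto intro: mult_left_mono)
    ultimately have "norm (E y1 - E y2) \<le> 2 * (e * (t * N))"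
      using norm_triangle_ineq4[of "E y1" "E y2"] by linarith
    then have "norm ((E y1 - E y2) v) \<le> 2 * (e * (t * N)) * norm v"
      using norm_blinfun[of "E y1 - E y2" v]
      by (meson mult_right_mono norm_ge_zero order_trans)
    then have "t * norm ((E y1 - E y2) v) \<le> t * (2 * (e * (t * N)) * norm v)"
      using t by (intro mult_left_mono) auto
    then have B: "t * norm ((E y1 - E y2) v) \<le> B" by (simp add: B_def algebra_simps)
    \<comment> \<open>\<open>D2\<close> is linear and the two points differ by \<open>t\<close>
      times \<open>u\<close>, so only the remainders \<open>E\<close> are left to estimate.\<close>
    have "E y1 - E y2 = D (x + y1) - D (x + y2) - t *\<^sub>R D2 u"
      unfolding E_def using linear_add[OF lin] linear_scale[OF lin]
      by (simp add: y1_def y2_def)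
    then have "k' r h = (h * t) *\<^sub>R (E y1 - E y2) v"
      by (simp add: k'_def y1_def y2_def w_def blinfun.bilinear_simps scaleR_diff_right add.assoc)
    then have "norm (k' r h) = \<bar>h\<bar> * (t * norm ((E y1 - E y2) v))"
      using t by (simp add: abs_mult)
    also have "\<dots> \<le> \<bar>h\<bar> * B" using B by (intro mult_left_mono) auto
    finally show "norm (k' r h) \<le> B * norm h" by (simp add: mult.commute)
  qed
  have "norm (k 1 - k 0) \<le> B * norm (1 - 0 :: real)"
    by (rule differentiable_bound[OF _ der bd]) auto
  then show ?thesis by (simp add: k_def B_def w_def N_def algebra_simps)
qed

text \<open>The second difference is unchanged when \<open>u\<close> and \<open>v\<close> are
  swapped, while \<open>D2 u v\<close> and \<open>D2 v u\<close>, scaled by \<open>t * t\<close>,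
  both approximate it up to an arbitrarily small multiple of \<open>t * t\<close>.\<close>

lemma second_derivative_symmetric:
  fixes f :: "'a::real_normed_vector \<Rightarrow> 'b::real_normed_vector"
    and D :: "'a \<Rightarrow> 'a \<Rightarrow>\<^sub>L 'b"
  assumes S: "open S" "x \<in> S"
    and f: "\<And>y. y \<in> S \<Longrightarrow> (f has_derivative blinfun_apply (D y)) (at y)"
    and D: "(D has_derivative D2) (at x)"
  shows "D2 u v = D2 v u"
proof -
  define C where "C = 2 * (norm u + norm v) * norm v + 2 * (norm v + norm u) * norm u"
  have C: "0 \<le> C" by (simp add: C_def)
  have lin: "linear D2" using D by (rule has_derivative_linear)
  have bound: "norm (D2 u v - D2 v u) \<le> e * C" if e: "0 < e" for e
  proof -
    obtain d1 where d1: "0 < d1" "ball x d1 \<subseteq> S" using S by (rule openE)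
    obtain d2 where d2: "0 < d2"
      "\<And>y. norm (y - x) < d2 \<Longrightarrow> norm (D y - D x - D2 (y - x)) \<le> e * norm (y - x)"
      using D e unfolding has_derivative_at_alt by blast
    define d where "d = min d1 d2"
    define N where "N = norm u + norm v"
    \<comment> \<open>The \<open>+ 1\<close> keeps the denominator positive when \<open>u\<close>
      and \<open>v\<close> vanish.\<close>
    define t where "t = d / (2 * (N + 1))"
    have "0 \<le> N" "0 < d" using d1 d2 by (auto simp: N_def d_def)
    moreover from this have "0 \<le> N * d" by simp
    ultimately have "0 < N * d + d * 2" by linarith
    with \<open>0 \<le> N\<close> \<open>0 < d\<close> have t: "0 < t" "t * N < d" by (auto simp: t_def field_simps)
    have f': "(f has_derivative blinfun_apply (D y)) (at y)" if "norm (y - x) < d" for y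
      using that d1 by (intro f) (auto simp: d_def dist_norm norm_minus_commute subset_iff)
    have D': "norm (D y - D x - D2 (y - x)) \<le> e * norm (y - x)" if "norm (y - x) < d" for y
      using that d2 by (simp add: d_def)
    have 1: "norm (f (x + t *\<^sub>R u + t *\<^sub>R v) - f (x + t *\<^sub>R u) - f (x + t *\<^sub>R v) + f x
               - (t * t) *\<^sub>R D2 u v) \<le> e * (t * t) * (2 * (norm u + norm v) * norm v)"
      by (rule second_difference_bound[OF f' D' lin]) (use t e in \<open>auto simp: N_def\<close>)
    have 2: "norm (f (x + t *\<^sub>R v + t *\<^sub>R u) - f (x + t *\<^sub>R v) - f (x + t *\<^sub>R u) + f x
               - (t * t) *\<^sub>R D2 v u) \<le> e * (t * t) * (2 * (norm v + norm u) * norm u)"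
      by (rule second_difference_bound[OF f' D' lin]) (use t e in \<open>auto simp: N_def add.commute\<close>)
    have "(t * t) *\<^sub>R (D2 u v - D2 v u)
        = (f (x + t *\<^sub>R v + t *\<^sub>R u) - f (x + t *\<^sub>R v) - f (x + t *\<^sub>R u) + f x - (t * t) *\<^sub>R D2 v u)
        - (f (x + t *\<^sub>R u + t *\<^sub>R v) - f (x + t *\<^sub>R u) - f (x + t *\<^sub>R v) + f x - (t * t) *\<^sub>R D2 u v)"
      by (simp add: algebra_simps)
    then have "norm ((t * t) *\<^sub>R (D2 u v - D2 v u))
        \<le> e * (t * t) * (2 * (norm v + norm u) * norm u) + e * (t * t) * (2 * (norm u + norm v) * norm v)"
      using norm_triangle_ineq4 1 2 by (smt (verit))
    also have "\<dots> = (t * t) * (e * C)" by (simp add: C_def algebra_simps)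
    finally have "(t * t) * norm (D2 u v - D2 v u) \<le> (t * t) * (e * C)" by simp
    then show ?thesis using t by (simp add: mult_le_cancel_left)
  qed
  have "norm (D2 u v - D2 v u) \<le> 0"
  proof (rule field_le_epsilon)
    fix e :: real assume "0 < e"
    \<comment> \<open>\<open>C\<close> can be 0, hence the division by \<open>C + 1\<close>.\<close>
    then have "norm (D2 u v - D2 v u) \<le> e / (C + 1) * C" using C by (intro bound) auto
    also have "\<dots> \<le> e" using C \<open>0 < e\<close> by (simp add: field_simps)
    finally show "norm (D2 u v - D2 v u) \<le> 0 + e" by simp
  qed
  then show ?thesis by simp
qed

section \<open>Conformal and anticonformal parts, singular values\<close>

text \<open>For the differential of a planar map, \<open>conf\<close> and \<open>anti\<close> are the Wirtinger
  derivatives \<open>\<partial>\<phi>/\<partial>z\<close> and \<open>\<partial>\<phi>/\<partial>(cnj z)\<close>.\<close>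

definition conf :: "real^2^2 \<Rightarrow> complex" where
  "conf A = Complex ((A$1$1 + A$2$2) / 2) ((A$2$1 - A$1$2) / 2)"

definition anti :: "real^2^2 \<Rightarrow> complex" where
  "anti A = Complex ((A$1$1 - A$2$2) / 2) ((A$2$1 + A$1$2) / 2)"

lemma conf_anti_sel [simp]:
  "Re (conf A) = (A$1$1 + A$2$2) / 2" "Im (conf A) = (A$2$1 - A$1$2) / 2"
  "Re (anti A) = (A$1$1 - A$2$2) / 2" "Im (anti A) = (A$2$1 + A$1$2) / 2"
  by (simp_all add: conf_def anti_def)

text \<open>The matrix of multiplication by \<open>z\<close> when the plane is identified with the
  complex numbers; these are exactly the matrices on which \<open>anti\<close> vanishes.\<close>

definition cmatrix :: "complex \<Rightarrow> real^2^2" where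
  "cmatrix z = vector [vector [Re z, - Im z], vector [Im z, Re z]]"

lemma cmatrix_nth [simp]:
  "cmatrix z $ 1 $ 1 = Re z" "cmatrix z $ 1 $ 2 = - Im z"
  "cmatrix z $ 2 $ 1 = Im z" "cmatrix z $ 2 $ 2 = Re z"
  by (simp_all add: cmatrix_def)

lemma matrix_2_eq_iff:
  fixes A B :: "real^2^2"
  shows "A = B \<longleftrightarrow> A$1$1 = B$1$1 \<and> A$1$2 = B$1$2 \<and> A$2$1 = B$2$1 \<and> A$2$2 = B$2$2"
  by (auto simp: vec_eq_iff forall_2)

lemma matrix_mult_2_nth:
  fixes A B :: "real^2^2"
  shows "(A ** B) $ i $ j = A$i$1 * B$1$j + A$i$2 * B$2$j"
  by (simp add: matrix_matrix_mult_def sum_2)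

lemma norm_matrix_2:
  fixes A :: "real^2^2"
  shows "(norm A)\<^sup>2 = (A$1$1)\<^sup>2 + (A$1$2)\<^sup>2 + (A$2$1)\<^sup>2 + (A$2$2)\<^sup>2"
  by (simp add: norm_vec_def L2_set_def sum_2)

lemma cmod_conf_sq: "(cmod (conf A))\<^sup>2 = ((A$1$1 + A$2$2)\<^sup>2 + (A$2$1 - A$1$2)\<^sup>2) / 4"
  and cmod_anti_sq: "(cmod (anti A))\<^sup>2 = ((A$1$1 - A$2$2)\<^sup>2 + (A$2$1 + A$1$2)\<^sup>2) / 4"
  unfolding cmod_power2 by (simp_all add: power2_eq_square field_simps)

lemma det_conf_anti: "det A = (cmod (conf A))\<^sup>2 - (cmod (anti A))\<^sup>2"
  unfolding cmod_conf_sq cmod_anti_sq by (simp add: det_2 power2_eq_square field_simps)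

lemma norm_conf_anti: "(norm A)\<^sup>2 = 2 * (cmod (conf A))\<^sup>2 + 2 * (cmod (anti A))\<^sup>2"
  unfolding cmod_conf_sq cmod_anti_sq norm_matrix_2 by (simp add: power2_eq_square field_simps)

lemma eigenvalues_iff_det: "l \<in> eigenvalues M \<longleftrightarrow> det (M - mat l) = 0"
proof -
  have "l \<in> eigenvalues M \<longleftrightarrow> (\<exists>v. v \<noteq> 0 \<and> (M - mat l) *v v = 0)"
    by (simp add: eigenvalues_def matrix_vector_mult_diff_rdistrib matrix_scaleR matrix_scaleR_vector_ac
        flip: matrix_scaleR)
  also have "\<dots> \<longleftrightarrow> \<not> invertible (M - mat l)"
    unfolding invertible_left_inverse matrix_left_invertible_ker by blast
  finally show ?thesis by (simp add: invertible_det_nz)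
qed

text \<open>The Gram matrix has trace \<open>(norm A)\<^sup>2\<close> and determinant
  \<open>(det A)\<^sup>2\<close>; written in the two moduli, its characteristic polynomial
  factors.\<close>

lemma eigenvalues_gram:
  "eigenvalues (transpose A ** A) =
     {(cmod (conf A) + cmod (anti A))\<^sup>2, (cmod (conf A) - cmod (anti A))\<^sup>2}" (is "_ = {?r\<^sup>2, ?s\<^sup>2}")
proof -
  have "l \<in> eigenvalues (transpose A ** A) \<longleftrightarrow> l = ?r\<^sup>2 \<or> l = ?s\<^sup>2" for l
  proof -
    have "det (transpose A ** A - mat l) = l\<^sup>2 - (norm A)\<^sup>2 * l + (det A)\<^sup>2"
      unfolding norm_matrix_2
      by (simp add: det_2 matrix_mult_2_nth transpose_def mat_def power2_eq_square algebra_simps)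
    also have "\<dots> = (l - ?r\<^sup>2) * (l - ?s\<^sup>2)"
      unfolding norm_conf_anti det_conf_anti by (simp add: power2_eq_square algebra_simps)
    finally show ?thesis by (simp add: eigenvalues_iff_det)
  qed
  then show ?thesis by blast
qed

lemma
  shows sigma1_eq: "sigma1 A = cmod (conf A) + cmod (anti A)"
    and sigma2_eq: "sigma2 A = \<bar>cmod (conf A) - cmod (anti A)\<bar>"
proof -
  let ?r = "cmod (conf A)" and ?s = "cmod (anti A)"
  have "(?r - ?s)\<^sup>2 \<le> (?r + ?s)\<^sup>2"
    by (simp add: power2_eq_square algebra_simps)
  then show "sigma1 A = ?r + ?s" "sigma2 A = \<bar>?r - ?s\<bar>"
    by (simp_all add: sigma1_def sigma2_def eigenvalues_gram max_def min_def)
qed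

lemma cmod_anti_less_conf:
  assumes "0 < det A"
  shows "cmod (anti A) < cmod (conf A)"
  using assms unfolding det_conf_anti by (auto intro: power2_less_imp_less)

section \<open>Distance to the rotations and the polar factor\<close>

lemma SO2_eq: "A \<in> SO2 \<longleftrightarrow> (\<exists>z. cmod z = 1 \<and> A = cmatrix z)"
proof
  assume A: "A \<in> SO2"
  then have "transpose A ** A = mat 1" "det A = 1"
    by (auto simp: SO2_def rotation_matrix_def orthogonal_matrix)
  then have o: "(A$1$1)\<^sup>2 + (A$2$1)\<^sup>2 = 1" "(A$1$2)\<^sup>2 + (A$2$2)\<^sup>2 = 1"
    and d: "A$1$1 * A$2$2 - A$1$2 * A$2$1 = 1"
    by (auto simp: matrix_2_eq_iff matrix_mult_2_nth transpose_def mat_def det_2 power2_eq_square)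
  \<comment> \<open>The left-hand side is the sum of the squared column lengths minus twice the
    determinant, that is 1 + 1 - 2.\<close>
  have "(A$1$1 - A$2$2)\<^sup>2 + (A$2$1 + A$1$2)\<^sup>2 = 0"
    using o d by (simp add: power2_eq_square algebra_simps)
  then have "A$2$2 = A$1$1" "A$1$2 = - A$2$1" by (auto simp: sum_power2_eq_zero_iff)
  then have "A = cmatrix (Complex (A$1$1) (A$2$1))" by (simp add: matrix_2_eq_iff)
  moreover have "cmod (Complex (A$1$1) (A$2$1)) = 1" using o by (simp add: cmod_def)
  ultimately show "\<exists>z. cmod z = 1 \<and> A = cmatrix z" by blast
next
  assume "\<exists>z. cmod z = 1 \<and> A = cmatrix z"
  then obtain z where z: "cmod z = 1" "A = cmatrix z" by blast
  have "(Re z)\<^sup>2 + (Im z)\<^sup>2 = 1" using z by (simp flip: cmod_power2)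
  then show "A \<in> SO2"
    by (simp add: SO2_def rotation_matrix_def orthogonal_matrix z matrix_2_eq_iff
        matrix_mult_2_nth transpose_def mat_def det_2 power2_eq_square algebra_simps)
qed

lemma anti_SO2: "A \<in> SO2 \<Longrightarrow> anti A = 0"
  by (auto simp: SO2_eq anti_def complex_eq_iff)

lemma norm_diff_cmatrix:
  "(norm (A - cmatrix z))\<^sup>2 = 2 * (cmod (conf A - z))\<^sup>2 + 2 * (cmod (anti A))\<^sup>2"
proof -
  have "conf (A - cmatrix z) = conf A - z" "anti (A - cmatrix z) = anti A"
    by (auto simp: conf_def anti_def complex_eq_iff field_simps)
  then show ?thesis by (simp add: norm_conf_anti)
qed

text \<open>Rotations have no anticonformal part, so by Pythagoras only the distance from
  \<open>conf A\<close> to the unit circle is to be minimised; the nearest point is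
  \<open>sgn (conf A)\<close>.\<close>

lemma infdist_SO2:
  assumes "conf A \<noteq> 0"
  shows "infdist A SO2 = sqrt (2 * (cmod (conf A) - 1)\<^sup>2 + 2 * (cmod (anti A))\<^sup>2)" (is "_ = ?m")
proof (rule antisym)
  have dist: "dist A (cmatrix z) = sqrt (2 * (cmod (conf A - z))\<^sup>2 + 2 * (cmod (anti A))\<^sup>2)" for z
    unfolding dist_norm norm_diff_cmatrix[symmetric] by simp
  have "conf A - sgn (conf A) = (cmod (conf A) - 1) *\<^sub>R sgn (conf A)"
    using assms by (simp add: sgn_div_norm algebra_simps)
  then have "cmod (conf A - sgn (conf A)) = \<bar>cmod (conf A) - 1\<bar>"
    using assms by (simp add: norm_sgn)
  then have "dist A (cmatrix (sgn (conf A))) = ?m" by (simp add: dist)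
  moreover have "cmatrix (sgn (conf A)) \<in> SO2" unfolding SO2_eq using assms
    by (intro exI[of _ "sgn (conf A)"]) (simp add: norm_sgn)
  ultimately show "infdist A SO2 \<le> ?m" by (metis infdist_le)
  show "?m \<le> infdist A SO2"
  proof (subst infdist_notempty)
    show "SO2 \<noteq> {}" using \<open>cmatrix (sgn (conf A)) \<in> SO2\<close> by blast
    show "?m \<le> (INF a\<in>SO2. dist A a)"
    proof (rule cINF_greatest)
      show "SO2 \<noteq> {}" using \<open>cmatrix (sgn (conf A)) \<in> SO2\<close> by blast
      fix Q assume "Q \<in> SO2"
      then obtain z where z: "cmod z = 1" "Q = cmatrix z" by (auto simp: SO2_eq)
      have "\<bar>cmod (conf A) - 1\<bar> \<le> cmod (conf A - z)"
        using norm_triangle_ineq3[of "conf A" z] z by simp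
      then have "(cmod (conf A) - 1)\<^sup>2 \<le> (cmod (conf A - z))\<^sup>2"
        by (simp flip: abs_le_square_iff)
      then show "?m \<le> dist A Q" by (simp add: dist z)
    qed
  qed
qed

text \<open>Cayley--Hamilton: a square root \<open>S\<close> of \<open>M\<close> satisfies
  \<open>(tr S) S = M + (det S) I\<close>, and both \<open>det S\<close> and \<open>tr S\<close> are determined by \<open>M\<close>.\<close>

lemma psd_sqrt_unique:
  fixes S T :: "real^2^2"
  assumes S: "transpose S = S" "\<And>v. 0 \<le> v \<bullet> (S *v v)"
    and T: "transpose T = T" "\<And>v. 0 \<le> v \<bullet> (T *v v)"
    and eq: "S ** S = T ** T" and nz: "det S \<noteq> 0"
  shows "S = T"
proof -
  have psd: "0 \<le> R$1$1 \<and> 0 \<le> R$2$2 \<and> 0 \<le> det R \<and> R$1$2 = R$2$1"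
    if sym: "transpose R = R" and pos: "\<And>v. 0 \<le> v \<bullet> (R *v v)" for R :: "real^2^2"
  proof -
    have s: "R$1$2 = R$2$1" using arg_cong[OF sym, of "\<lambda>M. M$2$1"] by (simp add: transpose_def)
    have q: "0 \<le> x * x * R$1$1 + 2 * x * y * R$1$2 + y * y * R$2$2" for x y
      using pos[of "vector [x, y]"] s
      by (simp add: inner_vec_def matrix_vector_mult_def sum_2 algebra_simps)
    have d: "0 \<le> R$1$1" "0 \<le> R$2$2" using q[of 1 0] q[of 0 1] by auto
    have "0 \<le> det R"
    proof (cases "R$1$1 = 0")
      case True
      have "R$1$2 = 0"
      proof (rule ccontr)
        assume "R$1$2 \<noteq> 0"
        \<comment> \<open>This \<open>x\<close>, with \<open>y = 1\<close>, gives the quadratic form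
          the value -1.\<close>
        moreover have "0 \<le> 2 * (- (R$2$2 + 1) / (2 * R$1$2)) * 1 * R$1$2 + R$2$2"
          using q[of "- (R$2$2 + 1) / (2 * R$1$2)" 1] True by simp
        ultimately show False by (simp add: field_simps)
      qed
      then show ?thesis using s True by (simp add: det_2)
    next
      case False
      \<comment> \<open>At the vector \<open>(- R$1$2, R$1$1)\<close> the quadratic form equals
        \<open>R$1$1 * det R\<close>.\<close>
      have "0 \<le> R$1$1 * det R"
        using q[of "- R$1$2" "R$1$1"] s by (simp add: det_2 algebra_simps)
      then show ?thesis using False d by (simp add: zero_le_mult_iff)
    qed
    with d s show ?thesis by blast
  qed
  note pS = psd[OF S] and pT = psd[OF T]
  have "(det S)\<^sup>2 = (det T)\<^sup>2"
    using arg_cong[OF eq, of det] by (simp add: det_mul power2_eq_square)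
  then have det: "det S = det T" using pS pT by (simp add: power2_eq_iff_nonneg)
  have CH: "(R$1$1 + R$2$2) *\<^sub>R R = R ** R + mat (det R)" for R :: "real^2^2"
    by (simp add: matrix_2_eq_iff matrix_mult_2_nth mat_def det_2 algebra_simps)
  have tr: "(R$1$1 + R$2$2)\<^sup>2 = (R ** R)$1$1 + (R ** R)$2$2 + 2 * det R" for R :: "real^2^2"
    by (simp add: matrix_mult_2_nth det_2 power2_eq_square algebra_simps)
  have "(S$1$1 + S$2$2)\<^sup>2 = (T$1$1 + T$2$2)\<^sup>2" by (simp add: tr eq det)
  then have tr_eq: "S$1$1 + S$2$2 = T$1$1 + T$2$2"
    using pS pT by (simp add: power2_eq_iff_nonneg)
  have "S$1$1 + S$2$2 \<noteq> 0"
  proof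
    assume "S$1$1 + S$2$2 = 0"
    then have "S$1$1 = 0" "S$2$2 = 0" using pS by linarith+
    then have "det S = - (S$1$2)\<^sup>2" using pS by (simp add: det_2 power2_eq_square)
    with pS nz show False by (smt (verit) zero_le_power2)
  qed
  moreover have "(S$1$1 + S$2$2) *\<^sub>R S = (S$1$1 + S$2$2) *\<^sub>R T"
    using CH[of S] CH[of T] eq det tr_eq by simp
  ultimately show ?thesis by simp
qed

text \<open>Rotating by the transpose of \<open>Q\<close> makes the conformal part of
  \<open>A\<close> the positive real number \<open>cmod (conf A)\<close>. Hence \<open>S\<close> is
  symmetric with positive trace, and as \<open>det S = det A > 0\<close> it is positive definite, so
  \<open>A = Q ** S\<close> is the polar decomposition.\<close>

lemma polar_factor_eq:
  assumes "0 < det A"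
  shows "polar_factor A = cmatrix (sgn (conf A))"
proof -
  define Q where "Q = cmatrix (sgn (conf A))"
  define S where "S = transpose Q ** A"
  have r: "0 < cmod (conf A)" using cmod_anti_less_conf[OF assms] norm_ge_zero le_less_trans by blast
  have "Q \<in> SO2" unfolding Q_def SO2_eq using r
    by (intro exI[of _ "sgn (conf A)"]) (simp add: norm_sgn)
  then have Q: "orthogonal_matrix Q" "det Q = 1"
    by (auto simp: SO2_def rotation_matrix_def)
  then have QQ: "Q ** transpose Q = mat 1" "transpose Q ** Q = mat 1"
    by (auto simp: orthogonal_matrix_def)
  have Qn: "Q$1$1 = (A$1$1 + A$2$2) / (2 * cmod (conf A))" "Q$1$2 = (A$1$2 - A$2$1) / (2 * cmod (conf A))"
    "Q$2$1 = (A$2$1 - A$1$2) / (2 * cmod (conf A))" "Q$2$2 = (A$1$1 + A$2$2) / (2 * cmod (conf A))"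
    by (simp_all add: Q_def Re_sgn Im_sgn minus_divide_left)
  have sym: "transpose S = S"
    by (simp add: S_def matrix_2_eq_iff matrix_mult_2_nth transpose_def Qn) 
       (simp add: algebra_simps add_divide_distrib diff_divide_distrib)
  have detS: "det S = det A" by (simp add: S_def det_mul Q)
  have tr: "0 \<le> S$1$1 + S$2$2"
  proof -
    have "S$1$1 + S$2$2 = ((A$1$1 + A$2$2)\<^sup>2 + (A$2$1 - A$1$2)\<^sup>2) / (2 * cmod (conf A))"
      by (simp add: S_def matrix_mult_2_nth transpose_def Qn)
        (simp add: algebra_simps add_divide_distrib diff_divide_distrib power2_eq_square)
    then show ?thesis using r by simp
  qed
  have pos: "0 \<le> v \<bullet> (S *v v)" for v
  proof -
    have s: "S$1$2 = S$2$1" using arg_cong[OF sym, of "\<lambda>M. M$2$1"] by (simp add: transpose_def)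
    have q: "v \<bullet> (S *v v) = v$1 * v$1 * S$1$1 + 2 * v$1 * v$2 * S$1$2 + v$2 * v$2 * S$2$2"
      using s by (simp add: inner_vec_def matrix_vector_mult_def sum_2 algebra_simps)
    have d: "0 < S$1$1 * S$2$2 - S$1$2 * S$1$2" using detS assms s by (simp add: det_2)
    then have "0 < S$1$1 * S$2$2" by (smt (verit) zero_le_square)
    then have p: "0 < S$1$1" "0 < S$2$2" using tr by (auto simp: zero_less_mult_iff)
    have "S$1$1 * (v \<bullet> (S *v v)) = (v$1 * S$1$1 + v$2 * S$1$2)\<^sup>2 + v$2 * v$2 * (S$1$1 * S$2$2 - S$1$2 * S$1$2)"
      by (simp add: q power2_eq_square algebra_simps)
    also have "\<dots> \<ge> 0" using d by simp
    finally show ?thesis using p by (simp add: zero_le_mult_iff)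
  qed
  have SS: "S ** S = transpose A ** A"
  proof -
    have "S ** S = transpose S ** S" by (simp add: sym)
    also have "\<dots> = transpose A ** (Q ** transpose Q) ** A"
      by (simp add: S_def matrix_transpose_mul matrix_mul_assoc)
    finally show ?thesis by (simp add: QQ)
  qed
  have "mat_sqrt (transpose A ** A) = S"
    unfolding mat_sqrt_def
  proof (rule the_equality)
    show "transpose S = S \<and> (\<forall>v. 0 \<le> v \<bullet> (S *v v)) \<and> S ** S = transpose A ** A"
      using sym pos SS by blast
    show "T = S" if "transpose T = T \<and> (\<forall>v. 0 \<le> v \<bullet> (T *v v)) \<and> T ** T = transpose A ** A" for T
      using psd_sqrt_unique[of S T] that sym pos SS detS assms by auto
  qed
  moreover have "A ** matrix_inv S = Q"
  proof -
    have "invertible S" using detS assms by (simp add: invertible_det_nz)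
    then have "S ** matrix_inv S = mat 1"
      unfolding invertible_def matrix_inv_def by (rule someI2_ex) blast
    moreover have "A = Q ** S" by (simp add: S_def matrix_mul_assoc QQ)
    ultimately show ?thesis by (metis matrix_mul_assoc matrix_mul_rid)
  qed
  ultimately show ?thesis by (simp add: polar_factor_def Q_def)
qed

section \<open>Differentiation along lines and functions of constant modulus\<close>

lemma eventually_line:
  fixes x v :: "'a::real_normed_vector"
  assumes "open S" "x \<in> S"
  shows "\<forall>\<^sub>F t in nhds 0. x + t *\<^sub>R v \<in> S"
proof -
  have "((\<lambda>t. x + t *\<^sub>R v) \<longlongrightarrow> x + 0 *\<^sub>R v) (nhds 0)"
    by (intro tendsto_intros filterlim_ident)
  then show ?thesis using assms by (simp add: topological_tendstoD)
qed

lemma DERIV_eventually_eq: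
  fixes f g :: "real \<Rightarrow> real"
  assumes "(f has_real_derivative d) (at x)" "\<forall>\<^sub>F t in nhds x. f t = g t"
  shows "(g has_real_derivative d) (at x)"
  using assms DERIV_cong_ev[OF refl assms(2) refl] by simp

text \<open>A curve on a circle about 0 moves orthogonally to its position; meant for the real and
  imaginary parts of \<open>conf\<close> and \<open>anti\<close> along coordinate lines.\<close>

lemma sum_squares_const_derivative:
  fixes f g :: "real \<Rightarrow> real"
  assumes "(f has_real_derivative f') (at a)" "(g has_real_derivative g') (at a)"
    and "\<forall>\<^sub>F t in nhds a. (f t)\<^sup>2 + (g t)\<^sup>2 = c"
  shows "f a * f' + g a * g' = 0"
proof -
  have "((\<lambda>t. (f t)\<^sup>2 + (g t)\<^sup>2) has_real_derivative 2 * (f a * f' + g a * g')) (at a)"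
    by (rule derivative_eq_intros assms refl | simp)+
  moreover have "((\<lambda>t. (f t)\<^sup>2 + (g t)\<^sup>2) has_real_derivative 0) (at a)"
    using DERIV_cong_ev[OF refl assms(3) refl] DERIV_const by blast
  ultimately show ?thesis using DERIV_unique by fastforce
qed

text \<open>With \<open>e = 1\<close> and \<open>e = -1\<close> the linear relations are the Cauchy--Riemann equations of a
  holomorphic and of an antiholomorphic function \<open>a + i b\<close>; the first two hypotheses say that
  the modulus is stationary.\<close>

lemma const_modulus_Cauchy_Riemann:
  fixes a b a1 a2 b1 b2 e :: real
  assumes "a * a1 + b * b1 = 0" "a * a2 + b * b2 = 0"
    and "b2 = e * a1" "b1 = - e * a2" "e * e = 1" "a\<^sup>2 + b\<^sup>2 \<noteq> 0"
  shows "a1 = 0 \<and> a2 = 0 \<and> b1 = 0 \<and> b2 = 0"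
proof -
  \<comment> \<open>Inserting the Cauchy-Riemann relations leaves a linear system for
    \<open>a1\<close>, \<open>a2\<close> with determinant \<open>a\<^sup>2 + b\<^sup>2\<close>;
    these are the combinations of Cramer's rule.\<close>
  have "(a\<^sup>2 + b\<^sup>2) * a1 = a * (a * a1 + b * b1) + e * b * (a * a2 + b * b2)"
    unfolding assms(3,4) using assms(5) by (simp add: power2_eq_square algebra_simps)
  moreover have "(a\<^sup>2 + b\<^sup>2) * a2 = a * (a * a2 + b * b2) - e * b * (a * a1 + b * b1)"
    unfolding assms(3,4) using assms(5) by (simp add: power2_eq_square algebra_simps)
  ultimately have "a1 = 0" "a2 = 0" using assms by auto
  with assms show ?thesis by simp
qed

lemma matrix_nth: "matrix f $ i $ j = f (axis j 1) $ i"
  by (simp add: matrix_def)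

lemma jacobian_eq: "(f has_derivative f') (at x) \<Longrightarrow> jacobian f (at x) = matrix f'"
  unfolding jacobian_def by (metis frechet_derivative_at)

lemma has_derivative_imp_line:
  fixes f :: "'a::real_normed_vector \<Rightarrow> real"
  assumes "(f has_derivative f') (at x)"
  shows "((\<lambda>t. f (x + t *\<^sub>R v)) has_real_derivative f' v) (at 0)"
proof -
  have "((\<lambda>t. x + t *\<^sub>R v) has_derivative (\<lambda>t. t *\<^sub>R v)) (at 0)"
    by (rule derivative_eq_intros refl | simp)+
  then have "((\<lambda>t. f (x + t *\<^sub>R v)) has_derivative (\<lambda>t. f' (t *\<^sub>R v))) (at 0)"
    by (rule has_derivative_compose) (use assms in simp)
  moreover have "(\<lambda>t. f' (t *\<^sub>R v)) = (\<lambda>t. f' v * t)"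
    using linear_scale[OF has_derivative_linear[OF assms]] by (simp add: mult.commute)
  ultimately show ?thesis by (simp add: has_field_derivative_def)
qed

section \<open>Vanishing second derivatives and affine maps\<close>

lemma bilinear_2_zero:
  fixes B :: "(real^2) \<Rightarrow>\<^sub>L ((real^2) \<Rightarrow>\<^sub>L (real^2))"
  assumes "\<And>i j k. B (axis k 1) (axis j 1) $ i = 0"
  shows "B = 0"
proof (intro blinfun_eqI)
  fix u v :: "real^2"
  have z: "B (axis k 1) (axis j 1) = 0" for j k using assms by (simp add: vec_eq_iff)
  have e: "w = w$1 *\<^sub>R axis 1 1 + w$2 *\<^sub>R axis 2 1" for w :: "real^2"
    by (simp add: vec_eq_iff forall_2 axis_def)
  show "B u v = (0 :: (real^2) \<Rightarrow>\<^sub>L ((real^2) \<Rightarrow>\<^sub>L (real^2))) u v"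
    by (subst e[of u], subst e[of v]) (simp add: blinfun.bilinear_simps z)
qed

text \<open>Integrate twice over the connected set: first \<open>D\<close> is constant, then so is
  the difference of \<open>\<phi>\<close> and the linear map \<open>D a\<close>.\<close>

lemma affine_of_zero_second_derivative:
  assumes "open \<Omega>" "connected \<Omega>"
    and f: "\<And>x. x \<in> \<Omega> \<Longrightarrow> (\<phi> has_derivative blinfun_apply (D x)) (at x)"
    and D: "\<And>x. x \<in> \<Omega> \<Longrightarrow> (D has_derivative (\<lambda>h. 0)) (at x)"
  shows "affine_map_on \<Omega> \<phi>"
proof (cases "\<Omega> = {}")
  case False
  then obtain a where a: "a \<in> \<Omega>" by blast
  have eq: "D x = D a" if "x \<in> \<Omega>" for x
    using has_derivative_zero_unique_connected[OF assms(1,2) D] that a by blast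
  have "((\<lambda>x. \<phi> x - D a x) has_derivative (\<lambda>h. 0)) (at x)" if "x \<in> \<Omega>" for x
    by (rule derivative_eq_intros f that refl | simp add: eq that)+
  then have "\<phi> x - D a x = \<phi> a - D a a" if "x \<in> \<Omega>" for x
    using has_derivative_zero_unique_connected[OF assms(1,2)] that a by blast
  moreover have "matrix (D a) *v x = D a x" for x
    by (simp add: matrix_works bounded_linear.linear[OF blinfun.bounded_linear_right])
  ultimately have "\<forall>x\<in>\<Omega>. \<phi> x = matrix (D a) *v x + (\<phi> a - D a a)"
    by (simp add: algebra_simps)
  then show ?thesis unfolding affine_map_on_def by blast
qed (simp add: affine_map_on_def)

section \<open>The Euler-Lagrange field and the rigidity argument\<close>

text \<open>A nonzero anticonformal part keeps \<open>A\<close> outside \<open>SO2\<close>, so the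
  zero branch of \<open>EL_field\<close> is not taken. The scalar factor depends only on the two
  moduli.\<close>

lemma EL_field_eq:
  assumes "0 < det A" "anti A \<noteq> 0"
  shows "EL_field p A =
    sqrt (2 * (cmod (conf A) - 1)\<^sup>2 + 2 * (cmod (anti A))\<^sup>2) powr (p - 2) *\<^sub>R
      (A - cmatrix (sgn (conf A)))"
proof -
  have "conf A \<noteq> 0" using cmod_anti_less_conf[OF assms(1)] by auto
  moreover have "A \<notin> SO2" using anti_SO2 assms by blast
  ultimately show ?thesis by (simp add: EL_field_def infdist_SO2 polar_factor_eq assms)
qed

theorem proposition1p7:
  fixes \<Omega> :: "(real^2) set" and \<phi> :: "real^2 \<Rightarrow> real^2"
  assumes "open \<Omega>" and "connected \<Omega>"
    and "C2_on \<Omega> \<phi>"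
    and "\<forall>x\<in>\<Omega>. det (jacobian \<phi> (at x)) > 0"
    and "\<forall>x\<in>\<Omega>. \<forall>y\<in>\<Omega>. sigma1 (jacobian \<phi> (at x)) = sigma1 (jacobian \<phi> (at y))
                     \<and> sigma2 (jacobian \<phi> (at x)) = sigma2 (jacobian \<phi> (at y))"
    and "\<exists>p\<ge>1. Ep_critical p \<Omega> \<phi>"
  shows "affine_map_on \<Omega> \<phi> \<or> (\<forall>x\<in>\<Omega>. jacobian \<phi> (at x) \<in> K)"
proof (cases "\<Omega> = {}")
  case True
  then show ?thesis by simp
next
  case False
  then obtain x0 where x0: "x0 \<in> \<Omega>" by blast
  define J where "J = (\<lambda>x. jacobian \<phi> (at x))"
  define r where "r = cmod (conf (J x0))"
  define s where "s = cmod (anti (J x0))"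
  have det: "0 < det (J x)" if "x \<in> \<Omega>" for x using assms(4) that by (simp add: J_def)
  \<comment> \<open>As the determinant is positive, the singular values are the sum and the
    difference of the two moduli and so determine them.\<close>
  have rs: "cmod (conf (J x)) = r" "cmod (anti (J x)) = s" if "x \<in> \<Omega>" for x
  proof -
    have "sigma1 (J x) = sigma1 (J x0)" "sigma2 (J x) = sigma2 (J x0)"
      using assms(5) that x0 unfolding J_def by blast+
    then show "cmod (conf (J x)) = r" "cmod (anti (J x)) = s"
      using cmod_anti_less_conf[OF det[OF that]] cmod_anti_less_conf[OF det[OF x0]]
      by (auto simp: sigma1_eq sigma2_eq r_def s_def)
  qed
  have sr: "0 \<le> s" "s < r"
    using cmod_anti_less_conf[OF det[OF x0]] by (simp_all add: r_def s_def)
  have rs_sq: "(Re (conf (J x)))\<^sup>2 + (Im (conf (J x)))\<^sup>2 = r\<^sup>2"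
    "(Re (anti (J x)))\<^sup>2 + (Im (anti (J x)))\<^sup>2 = s\<^sup>2" if "x \<in> \<Omega>" for x
    using rs[OF that] by (metis cmod_power2)+
  obtain D D2 where
    D: "\<And>x. x \<in> \<Omega> \<Longrightarrow> (\<phi> has_derivative blinfun_apply (D x)) (at x)"
    and D2: "\<And>x. x \<in> \<Omega> \<Longrightarrow> (D has_derivative blinfun_apply (D2 x)) (at x)"
    using assms(3) unfolding C2_on_def by blast
  \<comment> \<open>\<open>H x i j k\<close> is the derivative of entry \<open>(i, j)\<close> of the
    Jacobian in direction \<open>k\<close>.\<close>
  define H where "H = (\<lambda>x i j k. D2 x (axis k 1) (axis j 1) $ i)"
  have sym: "H x i j k = H x i k j" if "x \<in> \<Omega>" for x i j k
    using second_derivative_symmetric[OF assms(1) that D D2[OF that]] by (simp add: H_def)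
  have ev: "\<forall>\<^sub>F t in nhds 0. x + t *\<^sub>R axis k 1 \<in> \<Omega>" if "x \<in> \<Omega>" for x and k :: 2
    using eventually_line assms(1) that by blast
  have derJ: "((\<lambda>t. J (x + t *\<^sub>R axis k 1) $ i $ j) has_real_derivative H x i j k) (at 0)"
    if "x \<in> \<Omega>" for x i j k
  proof -
    have "((\<lambda>y. D y (axis j 1) $ i) has_derivative (\<lambda>h. D2 x h (axis j 1) $ i)) (at x)"
      using bounded_linear.has_derivative[OF bounded_linear_compose[OF bounded_linear_vec_nth
            blinfun.bounded_linear_left] D2[OF that]] .
    then have "((\<lambda>t. D (x + t *\<^sub>R axis k 1) (axis j 1) $ i) has_real_derivative H x i j k) (at 0)"
      unfolding H_def by (rule has_derivative_imp_line)
    moreover have "\<forall>\<^sub>F t in nhds 0.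
        D (x + t *\<^sub>R axis k 1) (axis j 1) $ i = J (x + t *\<^sub>R axis k 1) $ i $ j"
      using ev[OF that, of k] by eventually_elim (simp add: J_def jacobian_eq[OF D] matrix_nth)
    ultimately show ?thesis by (rule DERIV_eventually_eq)
  qed
  have orth: "Re (conf (J x)) * ((H x 1 1 k + H x 2 2 k) / 2) + Im (conf (J x)) * ((H x 2 1 k - H x 1 2 k) / 2) = 0"
    "Re (anti (J x)) * ((H x 1 1 k - H x 2 2 k) / 2) + Im (anti (J x)) * ((H x 2 1 k + H x 1 2 k) / 2) = 0"
    if x: "x \<in> \<Omega>" for x k
  proof -
    let ?y = "\<lambda>t. x + t *\<^sub>R axis k 1"
    have d: "((\<lambda>t. Re (conf (J (?y t)))) has_real_derivative (H x 1 1 k + H x 2 2 k) / 2) (at 0)"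
      "((\<lambda>t. Im (conf (J (?y t)))) has_real_derivative (H x 2 1 k - H x 1 2 k) / 2) (at 0)"
      "((\<lambda>t. Re (anti (J (?y t)))) has_real_derivative (H x 1 1 k - H x 2 2 k) / 2) (at 0)"
      "((\<lambda>t. Im (anti (J (?y t)))) has_real_derivative (H x 2 1 k + H x 1 2 k) / 2) (at 0)"
      unfolding conf_anti_sel by (rule derivative_eq_intros derJ x refl | simp)+
    show "Re (conf (J x)) * ((H x 1 1 k + H x 2 2 k) / 2) + Im (conf (J x)) * ((H x 2 1 k - H x 1 2 k) / 2) = 0"
      using sum_squares_const_derivative[OF d(1,2) eventually_mono[OF ev[OF x, of k] rs_sq(1)]]
      by simp
    show "Re (anti (J x)) * ((H x 1 1 k - H x 2 2 k) / 2) + Im (anti (J x)) * ((H x 2 1 k + H x 1 2 k) / 2) = 0"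
      using sum_squares_const_derivative[OF d(3,4) eventually_mono[OF ev[OF x, of k] rs_sq(2)]]
      by simp
  qed
  show ?thesis
  proof (cases "2 * r = 1")
    case True
    \<comment> \<open>The singular values add up to
      \<open>(r + s) + (r - s) = 2 * r\<close>.\<close>
    have "J x \<in> K" if "x \<in> \<Omega>" for x
      using det[OF that] rs[OF that] sr True by (simp add: K_def sigma1_eq sigma2_eq)
    then show ?thesis by (simp add: J_def)
  next
    case r: False
    \<comment> \<open>For \<open>s = 0\<close> the second relation of \<open>orth\<close> reads
      \<open>0 = 0\<close>; instead \<open>anti (J y) = 0\<close> itself, the Cauchy-Riemann
      equations of \<open>\<phi>\<close>, is differentiated.\<close>
    have anti0: "H x 1 1 k = H x 2 2 k" "H x 2 1 k = - H x 1 2 k" if "s = 0" "x \<in> \<Omega>" for x k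
    proof -
      have "J y $ 1 $ 1 = J y $ 2 $ 2" "J y $ 2 $ 1 = - J y $ 1 $ 2" if "y \<in> \<Omega>" for y
        using rs(2)[OF that] \<open>s = 0\<close> by (auto simp: complex_eq_iff)
      then have "\<forall>\<^sub>F t in nhds 0. J (x + t *\<^sub>R axis k 1) $ 1 $ 1 = J (x + t *\<^sub>R axis k 1) $ 2 $ 2"
        "\<forall>\<^sub>F t in nhds 0. J (x + t *\<^sub>R axis k 1) $ 2 $ 1 = - J (x + t *\<^sub>R axis k 1) $ 1 $ 2"
        using ev[OF that(2), of k] by (auto elim: eventually_mono)
      then show "H x 1 1 k = H x 2 2 k" "H x 2 1 k = - H x 1 2 k"
        using DERIV_unique[OF DERIV_eventually_eq[OF derJ[OF that(2)]] derJ[OF that(2)]]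
          DERIV_unique[OF DERIV_eventually_eq[OF derJ[OF that(2)]] DERIV_minus[OF derJ[OF that(2)]]]
        by blast+
    qed
    have harm: "H x 1 1 1 + H x 1 2 2 = 0 \<and> H x 2 1 1 + H x 2 2 2 = 0" if x: "x \<in> \<Omega>" for x
    proof (cases "s = 0")
      case True
      then show ?thesis using anti0[OF True x, of 1] anti0[OF True x, of 2] sym[OF x, of 1 1 2] sym[OF x, of 2 1 2]
        by linarith
    next
      case False
      obtain p where "Ep_critical p \<Omega> \<phi>" using assms(6) by blast
      then obtain G :: "real^2^2" where
        G: "\<And>i j. ((\<lambda>t. EL_field p (J (x + t *\<^sub>R axis j 1)) $ i $ j) has_real_derivative G $ i $ j) (at 0)"
        and "0 = (\<chi> i. \<Sum>j\<in>UNIV. G $ i $ j)"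
        using x unfolding Ep_critical_def has_row_divergence_def J_def by blast
      then have div: "G $ i $ 1 + G $ i $ 2 = 0" for i by (simp add: vec_eq_iff sum_2)
      define c where "c = sqrt (2 * (r - 1)\<^sup>2 + 2 * s\<^sup>2) powr (p - 2)"
      \<comment> \<open>\<open>powr\<close> has value 0 at base 0, so the positivity of
        \<open>c\<close> rests on \<open>s \<noteq> 0\<close>.\<close>
      have "0 < 2 * (r - 1)\<^sup>2 + 2 * s\<^sup>2" using False by (simp add: add_nonneg_pos)
      then have c: "0 < c" unfolding c_def by simp
      have EL: "EL_field p (J y) = c *\<^sub>R (J y - cmatrix (sgn (conf (J y))))" if "y \<in> \<Omega>" for y
        using EL_field_eq[OF det[OF that], of p] rs[OF that] False by (auto simp: c_def)
      let ?L = "\<lambda>i j t. c * (J (x + t *\<^sub>R axis j 1) $ i $ j - cmatrix (sgn (conf (J (x + t *\<^sub>R axis j 1)))) $ i $ j)"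
      have GL: "(?L i j has_real_derivative G $ i $ j) (at 0)" for i j
      proof -
        have "\<forall>\<^sub>F t in nhds 0. EL_field p (J (x + t *\<^sub>R axis j 1)) $ i $ j = ?L i j t"
          using ev[OF x, of j] by eventually_elim (simp add: EL)
        with G show ?thesis by (rule DERIV_eventually_eq)
      qed
      \<comment> \<open>Replacing the modulus in \<open>sgn\<close> by the constant \<open>r\<close>
        before differentiating makes the field affine in the Jacobian; \<open>f A\<close> is the
        entry of \<open>cmatrix (conf A)\<close>.\<close>
      have GR: "((\<lambda>t. c * (J (x + t *\<^sub>R axis j 1) $ i $ j - f (J (x + t *\<^sub>R axis j 1)) / r)) has_real_derivative G $ i $ j) (at 0)"
        if "\<And>A. cmatrix (sgn (conf A)) $ i $ j = f A / cmod (conf A)" for i j f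
      proof -
        have "\<forall>\<^sub>F t in nhds 0. ?L i j t = c * (J (x + t *\<^sub>R axis j 1) $ i $ j - f (J (x + t *\<^sub>R axis j 1)) / r)"
          using ev[OF x, of j] by eventually_elim (simp add: that rs)
        with GL show ?thesis by (rule DERIV_eventually_eq)
      qed
      have "G$1$1 = c * (H x 1 1 1 - (H x 1 1 1 + H x 2 2 1) / 2 / r)"
        by (rule DERIV_unique[OF GR[of 1 1 "\<lambda>A. (A$1$1 + A$2$2) / 2"]])
          (simp add: Re_sgn, intro DERIV_cmult DERIV_diff DERIV_add DERIV_cdivide derJ x)
      moreover have "G$1$2 = c * (H x 1 2 2 - (H x 1 2 2 - H x 2 1 2) / 2 / r)"
        by (rule DERIV_unique[OF GR[of 1 2 "\<lambda>A. (A$1$2 - A$2$1) / 2"]])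
          (simp add: Im_sgn minus_divide_left, intro DERIV_cmult DERIV_diff DERIV_add DERIV_cdivide derJ x)
      moreover have "G$2$1 = c * (H x 2 1 1 - (H x 2 1 1 - H x 1 2 1) / 2 / r)"
        by (rule DERIV_unique[OF GR[of 2 1 "\<lambda>A. (A$2$1 - A$1$2) / 2"]])
          (simp add: Im_sgn, intro DERIV_cmult DERIV_diff DERIV_add DERIV_cdivide derJ x)
      moreover have "G$2$2 = c * (H x 2 2 2 - (H x 1 1 2 + H x 2 2 2) / 2 / r)"
        by (rule DERIV_unique[OF GR[of 2 2 "\<lambda>A. (A$1$1 + A$2$2) / 2"]])
          (simp add: Re_sgn, intro DERIV_cmult DERIV_diff DERIV_add DERIV_cdivide derJ x)
      \<comment> \<open>The conformal part is half the sum of the matrix and its cofactor matrix. By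
        symmetry the mixed derivatives cancel, so its row divergence is half the Laplacian.\<close>
      ultimately have "c * (2 * r - 1) * (H x 1 1 1 + H x 1 2 2) = 2 * r * (G$1$1 + G$1$2)"
        "c * (2 * r - 1) * (H x 2 1 1 + H x 2 2 2) = 2 * r * (G$2$1 + G$2$2)"
        using sr sym[OF x, of _ 1 2] by (simp_all add: field_simps)
      then show ?thesis using div c r by simp
    qed
    have zero: "H x i j k = 0" if x: "x \<in> \<Omega>" for x i j k
    proof -
      have "H x 1 1 1 + H x 1 2 2 = 0" "H x 2 1 1 + H x 2 2 2 = 0"
        "H x 1 1 2 = H x 1 2 1" "H x 2 1 2 = H x 2 2 1"
        using harm[OF x] sym[OF x] by blast+
      \<comment> \<open>The Laplacian is four times the product of the two Wirtinger operators, so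
        harmonicity gives the Cauchy-Riemann equations for \<open>conf\<close>
        (\<open>e = 1\<close>) and then for \<open>anti\<close> (\<open>e = -1\<close>).\<close>
      then have CR: "(H x 2 1 2 - H x 1 2 2) / 2 = 1 * ((H x 1 1 1 + H x 2 2 1) / 2)"
        "(H x 2 1 1 - H x 1 2 1) / 2 = - 1 * ((H x 1 1 2 + H x 2 2 2) / 2)"
        "(H x 2 1 2 + H x 1 2 2) / 2 = - 1 * ((H x 1 1 1 - H x 2 2 1) / 2)"
        "(H x 2 1 1 + H x 1 2 1) / 2 = - (- 1) * ((H x 1 1 2 - H x 2 2 2) / 2)"
        by (simp_all add: field_simps)
      have rnz: "(Re (conf (J x)))\<^sup>2 + (Im (conf (J x)))\<^sup>2 \<noteq> 0" using rs_sq(1)[OF x] sr by simp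
      have "(H x 1 1 1 + H x 2 2 1) / 2 = 0 \<and> (H x 1 1 2 + H x 2 2 2) / 2 = 0
          \<and> (H x 2 1 1 - H x 1 2 1) / 2 = 0 \<and> (H x 2 1 2 - H x 1 2 2) / 2 = 0"
        by (rule const_modulus_Cauchy_Riemann[OF orth(1)[OF x] orth(1)[OF x], where e = 1, OF CR(1,2) _ rnz]) simp
      moreover have "(H x 1 1 1 - H x 2 2 1) / 2 = 0 \<and> (H x 1 1 2 - H x 2 2 2) / 2 = 0
          \<and> (H x 2 1 1 + H x 1 2 1) / 2 = 0 \<and> (H x 2 1 2 + H x 1 2 2) / 2 = 0"
      proof (cases "s = 0")
        case True
        \<comment> \<open>With modulus 0 the Cauchy-Riemann argument does not apply, but
          \<open>anti\<close> vanishes identically.\<close>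
        then show ?thesis using anti0[OF True x] by simp
      next
        case False
        then have snz: "(Re (anti (J x)))\<^sup>2 + (Im (anti (J x)))\<^sup>2 \<noteq> 0" using rs_sq(2)[OF x] by simp
        show ?thesis
          by (rule const_modulus_Cauchy_Riemann[OF orth(2)[OF x] orth(2)[OF x], where e = "-1", OF CR(3,4) _ snz]) simp
      qed
      ultimately have "\<forall>i j k. H x i j k = 0" unfolding forall_2 by auto
      then show ?thesis by blast
    qed
    have "D2 x = 0" if "x \<in> \<Omega>" for x
      by (rule bilinear_2_zero) (use zero[OF that] in \<open>simp add: H_def\<close>)
    then have "(D has_derivative (\<lambda>h. 0)) (at x)" if "x \<in> \<Omega>" for x
      using D2[OF that] that by (simp add: zero_blinfun.rep_eq)
    then show ?thesis using affine_of_zero_second_derivative[OF assms(1,2) D] by blast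
  qed
qed

end
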